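(* For every integer $n\ge 1$, the number of domino tilings of the Aztec diamond of order $n$ is $2^{n(n+1)/2}$.
   Context: The Aztec diamond of order $n$, denoted $\mathrm{Az}(n)$, is the union of all the unit squares in the plane with integral corners $(x,y)$ (all four corners) satisfying $|x|+|y|\le n+1$. A domino is a $1\times 2$ or $2\times 1$ (axis-parallel) rectangle with integral corners. A domino tiling of a region $R$ is a set of non-overlapping dominos (i.e. with pairwise disjoint interiors) whose union is $R$. *)

theory Defs
  imports "HOL-Analysis.Analysis"
begin

definition lattice_rect :: "int \<Rightarrow> int \<Rightarrow> nat \<Rightarrow> nat \<Rightarrow> (real \<times> real) set" where
  "lattice_rect a b w h =
     {real_of_int a .. real_of_int a + real w} \<times> {real_of_int b .. real_of_int b + real h}"

definition unit_square :: "int \<Rightarrow> int \<Rightarrow> (real \<times> real) set" where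
  "unit_square a b = lattice_rect a b 1 1"

definition aztec_diamond :: "nat \<Rightarrow> (real \<times> real) set" where
  "aztec_diamond n =
     \<Union> {unit_square a b | a b.
          \<forall>x\<in>{a, a + 1}. \<forall>y\<in>{b, b + 1}. \<bar>x\<bar> + \<bar>y\<bar> \<le> int n + 1}"

definition is_domino :: "(real \<times> real) set \<Rightarrow> bool" where
  "is_domino D \<longleftrightarrow> (\<exists>a b. D = lattice_rect a b 1 2 \<or> D = lattice_rect a b 2 1)"

definition domino_tiling :: "(real \<times> real) set \<Rightarrow> (real \<times> real) set set \<Rightarrow> bool" where
  "domino_tiling R T \<longleftrightarrow>
     (\<forall>D\<in>T. is_domino D) \<and>
     (\<forall>D\<in>T. \<forall>E\<in>T. D \<noteq> E \<longrightarrow> interior D \<inter> interior E = {}) \<and>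
     \<Union> T = R"

end

theory Submission
  imports Defs
begin

text \<open>
  The tilings of consecutive Aztec diamonds are compared by cutting both along the same family of
  two-by-two blocks of cells.  The blocks are centred at the \<open>(m + 1)\<^sup>2\<close> lattice points
  \<open>(x, y)\<close> with \<open>\<bar>x\<bar> + \<bar>y\<bar> \<le> m\<close> and \<open>x + y \<equiv> m (mod 2)\<close>, called nodes below.  The edge
  shared by the two cells of a domino has two end points, of opposite parity, so every domino of the diamond of order \<open>m + 1\<close> lies in exactly one block
  (\<open>domino_in_unique_block\<close>).  A tiling of either diamond therefore amounts to a splitting, that
  is, a choice of a part \<open>U p\<close> of every block \<open>p\<close> such that the parts partition the diamond,
  together with a tiling of each part.  With \<open>t X\<close> the number of tilings of \<open>X\<close>, the diamond has
  \<open>\<Sum>\<^sub>U \<Prod>\<^sub>p t (U p)\<close> tilings (\<open>card_tilings_split\<close>).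

  A cell of the diamond of order \<open>m\<close> lies in two blocks, while a cell of the surrounding ring,
  which completes the diamond of order \<open>m + 1\<close>, lies in only one
  (\<open>card_blocks_through_cell\<close>).  Replacing every part by its complement in its block thus turns
  the splittings of the larger diamond bijectively into those of the smaller one
  (\<open>bij_betw_complement_splittings\<close>).

  The effect on the weights is local.  A part of a block has no tiling unless it is empty, a
  domino, or the whole block, and then it has 1, 1 or 2 tilings; hence
  \<open>2 * t X = t (block - X) * sqrt 2 ^ card X\<close> in all cases (\<open>local_complement\<close>).  In the product over all
  blocks the exponents add up to the number \<open>2 (m + 1) (m + 2)\<close> of cells of the larger diamond,
  so the weight of a splitting is \<open>2 ^ ((m + 1) (m + 2) - (m + 1)\<^sup>2) = 2 ^ (m + 1)\<close> times that of its
  complement.  Summing over all splittings shows that the number of tilings gains a factor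
  \<open>2 ^ (m + 1)\<close> when the order grows from \<open>m\<close> to \<open>m + 1\<close>, and the theorem follows by induction from
  the empty diamond.

  A unit square is represented by its lower left corner, called a cell; that tilings of a region
  of the plane are the same as partitions of its set of cells into dominoes is checked by looking
  at the centres of the unit squares.
\<close>

section \<open>Domino tilings of sets of cells\<close>

definition dominoes :: "(int \<times> int) set set" where
  "dominoes = {D. \<exists>a b. D = {(a, b), (a, b + 1)} \<or> D = {(a, b), (a + 1, b)}}"

definition tilings :: "(int \<times> int) set \<Rightarrow> (int \<times> int) set set set" where
  "tilings R = {M. M \<subseteq> dominoes \<and> partition_on R M}"

lemma domino_card: "D \<in> dominoes \<Longrightarrow> card D = 2"
  by (auto simp: dominoes_def)

lemma domino_nonempty: "D \<in> dominoes \<Longrightarrow> D \<noteq> {}"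
  by (auto simp: dominoes_def)

lemma tilings_alt:
  "M \<in> tilings R \<longleftrightarrow> M \<subseteq> dominoes \<and> disjoint M \<and> \<Union> M = R"
  using domino_nonempty by (auto simp: tilings_def partition_on_def)

lemma finite_tilings: "finite R \<Longrightarrow> finite (tilings R)"
  by (rule finite_subset[of _ "Pow (Pow R)"]) (auto simp: tilings_alt)

lemma tilings_empty: "tilings {} = {{}}"
  by (auto simp: tilings_def partition_on_empty)

lemma tilings_odd: 
  assumes "odd (card X)"
  shows "tilings X = {}"
proof -
  have "even (card X)" if M: "M \<in> tilings X" for M
  proof -
    have "card X = (\<Sum>D\<in>M. card D)"
      using M domino_card card_Union_disjoint[of M]
      by (metis card.infinite card_gt_0_iff subsetD tilings_alt zero_less_numeral)
    also have "\<dots> = (\<Sum>D\<in>M. 2)"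
      using M domino_card by (intro sum.cong) (auto simp: tilings_alt)
    finally show ?thesis by simp
  qed
  then show ?thesis using assms by auto
qed

lemma tilings_pair: 
  assumes "card X = 2"
  shows "tilings X = (if X \<in> dominoes then {{X}} else {})"
proof -
  have fin: "finite X" using assms card.infinite by fastforce
  have "M = {X} \<and> X \<in> dominoes" if M: "M \<in> tilings X" for M
  proof -
    have all: "D = X" if "D \<in> M" for D
      using that M assms domino_card fin by (intro card_subset_eq) (auto simp: tilings_alt)
    moreover have "M \<noteq> {}" using M assms by (auto simp: tilings_alt)
    ultimately have "M = {X}" by auto
    then show ?thesis using M by (auto simp: tilings_alt)
  qed
  moreover have "{X} \<in> tilings X" if "X \<in> dominoes" using that by (auto simp: tilings_alt)
  ultimately show ?thesis by auto
qed

section \<open>Two-by-two blocks\<close>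

definition block :: "int \<times> int \<Rightarrow> (int \<times> int) set" where
  "block = (\<lambda>(x, y). {x - 1..x} \<times> {y - 1..y})"

lemma block_eq: "block (x, y) = {(x - 1, y - 1), (x - 1, y), (x, y - 1), (x, y)}"
proof -
  have "{z - 1..z} = {z - 1, z}" for z :: int by auto
  then show ?thesis by (auto simp: block_def)
qed

lemma mem_block: "(a, b) \<in> block (x, y) \<longleftrightarrow> (x = a \<or> x = a + 1) \<and> (y = b \<or> y = b + 1)"
  by (auto simp: block_def)

lemma finite_block: "finite (block p)"
  by (cases p) (simp add: block_eq)

lemma card_block: "card (block p) = 4"
  by (cases p) (simp add: block_eq)

lemma dominoes_in_block:
  "D \<in> dominoes \<and> D \<subseteq> block (x, y) \<longleftrightarrow>
     D \<in> {{(x - 1, y - 1), (x, y - 1)}, {(x - 1, y), (x, y)},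
           {(x - 1, y - 1), (x - 1, y)}, {(x, y - 1), (x, y)}}"
  (is "_ \<longleftrightarrow> D \<in> ?F")
proof
  assume D: "D \<in> dominoes \<and> D \<subseteq> block (x, y)"
  then obtain a b where "D = {(a, b), (a, b + 1)} \<or> D = {(a, b), (a + 1, b)}"
    by (auto simp: dominoes_def)
  then show "D \<in> ?F"
  proof
    assume ab: "D = {(a, b), (a, b + 1)}"
    then have "{(a, b), (a, b + 1)} \<subseteq> block (x, y)" using D by simp
    then have "b = y - 1" "a = x - 1 \<or> a = x" by (auto simp: block_def)
    then show ?thesis unfolding ab by (elim disjE) simp_all
  next
    assume ab: "D = {(a, b), (a + 1, b)}"
    then have "{(a, b), (a + 1, b)} \<subseteq> block (x, y)" using D by simp
    then have "a = x - 1" "b = y - 1 \<or> b = y" by (auto simp: block_def)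
    then show ?thesis unfolding ab by (elim disjE) simp_all
  qed
next
  have vertical: "{(i, j - 1), (i, j)} \<in> dominoes" and horizontal: "{(j - 1, i), (j, i)} \<in> dominoes"
    for i j :: int
  proof -
    show "{(i, j - 1), (i, j)} \<in> dominoes" unfolding dominoes_def
      by (intro CollectI exI[of _ i] exI[of _ "j - 1"]) simp
    show "{(j - 1, i), (j, i)} \<in> dominoes" unfolding dominoes_def
      by (intro CollectI exI[of _ "j - 1"] exI[of _ i]) simp
  qed
  show "D \<in> dominoes \<and> D \<subseteq> block (x, y)" if "D \<in> ?F"
    using that by (elim insertE emptyE) (simp_all add: vertical horizontal block_eq)
qed

text \<open>
  The four cells of a block, in abstract form: on a 4-cycle with edges \<open>pq\<close>, \<open>qs\<close>, \<open>sr\<close>, \<open>rp\<close> the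
  only perfect matchings are the two pairs of opposite edges, because the edge used at \<open>p\<close> forces
  the one used at the opposite vertex \<open>s\<close>.
\<close>

lemma disjoint_covers_of_four:
  assumes "distinct [p, q, r, s]"
  shows "M \<subseteq> {{p, q}, {r, s}, {p, r}, {q, s}} \<and> disjoint M \<and> \<Union> M = {p, q, r, s} \<longleftrightarrow>
    M = {{p, q}, {r, s}} \<or> M = {{p, r}, {q, s}}"
proof
  assume M: "M \<subseteq> {{p, q}, {r, s}, {p, r}, {q, s}} \<and> disjoint M \<and> \<Union> M = {p, q, r, s}"
  have meet: "D = E" if "D \<in> M" "E \<in> M" "c \<in> D" "c \<in> E" for c D E
    using M that by (auto simp: disjoint_def)
  have pick: "M = {A, B}" if "M \<subseteq> {A, B, C, D}" "A \<in> M" "B \<in> M" "C \<notin> M" "D \<notin> M" for A B C D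
    using that by blast
  have s: "{r, s} \<in> M \<or> {q, s} \<in> M"
  proof -
    obtain E where E: "E \<in> M" "s \<in> E" using M by blast
    then have "E = {r, s} \<or> E = {q, s}" using M assms by auto
    with E show ?thesis by auto
  qed
  show "M = {{p, q}, {r, s}} \<or> M = {{p, r}, {q, s}}"
  proof (cases "{p, q} \<in> M")
    case True
    then have "{p, r} \<notin> M" "{q, s} \<notin> M"
      using meet[of "{p, q}" "{p, r}" p] meet[of "{p, q}" "{q, s}" q] assms
      by (auto simp: doubleton_eq_iff)
    then show ?thesis using pick[of "{p, q}" "{r, s}" "{p, r}" "{q, s}"] True s M by simp
  next
    case False
    obtain E where E: "E \<in> M" "p \<in> E" using M by blast
    then have "E = {p, r}" using M assms False by auto
    then have *: "{p, r} \<in> M" using E by simp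
    then have "{r, s} \<notin> M"
      using meet[of "{p, r}" "{r, s}" r] assms by (auto simp: doubleton_eq_iff)
    then have "M = {{p, r}, {q, s}}"
      using pick[of "{p, r}" "{q, s}" "{p, q}" "{r, s}"] * False s M by (simp add: insert_commute)
    then show ?thesis by simp
  qed
next
  assume "M = {{p, q}, {r, s}} \<or> M = {{p, r}, {q, s}}"
  then show "M \<subseteq> {{p, q}, {r, s}, {p, r}, {q, s}} \<and> disjoint M \<and> \<Union> M = {p, q, r, s}"
    using assms by (auto simp: disjoint_def)
qed

lemma card_tilings_block: "card (tilings (block p)) = 2"
proof -
  obtain x y where p: "p = (x, y)" by (cases p)
  define sw se nw ne where cells: "sw = (x - 1, y - 1)" "se = (x, y - 1)" "nw = (x - 1, y)" "ne = (x, y)"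
  define F where "F = {{sw, se}, {nw, ne}, {sw, nw}, {se, ne}}"
  have dist: "distinct [sw, se, nw, ne]" by (simp add: cells)
  have blk: "block p = {sw, se, nw, ne}"
    unfolding p block_eq cells by blast
  have dom: "D \<in> dominoes \<and> D \<subseteq> block p \<longleftrightarrow> D \<in> F" for D
    using dominoes_in_block[of D x y] unfolding p F_def cells .
  have "M \<in> tilings (block p) \<longleftrightarrow> M \<subseteq> F \<and> disjoint M \<and> \<Union> M = block p" for M
  proof -
    have "M \<subseteq> F \<longleftrightarrow> M \<subseteq> dominoes \<and> (\<forall>D\<in>M. D \<subseteq> block p)"
      unfolding subset_eq[of M] Ball_def dom[symmetric] by iprover
    then show ?thesis by (auto simp: tilings_alt)
  qed
  then have "tilings (block p) = {{{sw, se}, {nw, ne}}, {{sw, nw}, {se, ne}}}"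
    unfolding F_def blk disjoint_covers_of_four[OF dist] by (intro set_eqI) simp
  moreover have "{{sw, se}, {nw, ne}} \<noteq> {{sw, nw}, {se, ne}}"
    using dist by (auto simp: doubleton_eq_iff)
  ultimately show ?thesis by (metis card_2_iff)
qed

lemma domino_complement:
  assumes "D \<in> dominoes" "D \<subseteq> block p"
  shows "block p - D \<in> dominoes"
proof -
  obtain x y where p: "p = (x, y)" by (cases p)
  have diff: "block p - {(x - 1, y - 1), (x, y - 1)} = {(x - 1, y), (x, y)}"
    "block p - {(x - 1, y), (x, y)} = {(x - 1, y - 1), (x, y - 1)}"
    "block p - {(x - 1, y - 1), (x - 1, y)} = {(x, y - 1), (x, y)}"
    "block p - {(x, y - 1), (x, y)} = {(x - 1, y - 1), (x - 1, y)}"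
    unfolding p block_eq by (simp_all add: insert_Diff_if)
  define F where "F = {{(x - 1, y - 1), (x, y - 1)}, {(x - 1, y), (x, y)},
           {(x - 1, y - 1), (x - 1, y)}, {(x, y - 1), (x, y)}}"
  have F: "D \<in> F \<longleftrightarrow> D \<in> dominoes \<and> D \<subseteq> block p" for D
    using dominoes_in_block[of D x y] unfolding F_def p by (rule sym)
  have "block p - D \<in> F" if "D \<in> F" for D
    using that unfolding F_def by (elim insertE emptyE) (simp_all only: diff insert_iff simp_thms)
  then show ?thesis using assms unfolding F by iprover
qed

text \<open>
  Both sides vanish unless the part has a tiling, and then the identity reads \<open>2 = 2\<close>, \<open>2 = 2\<close> or
  \<open>4 = 4\<close> for 0, 2 or 4 cells.  The factor \<open>sqrt 2\<close> per cell makes the correction multiplicative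
  over blocks, so that in a product over a splitting it depends on the number of cells only.
\<close>

lemma local_complement:
  assumes "X \<subseteq> block p"
  shows "2 * real (card (tilings X)) = real (card (tilings (block p - X))) * sqrt 2 ^ card X"
proof -
  obtain x y where p: "p = (x, y)" by (cases p)
  have fin: "finite X" using assms finite_block finite_subset by blast
  have cardc: "card (block p - X) = 4 - card X"
    using card_Diff_subset[OF fin assms] by (simp add: card_block)
  have le: "card X \<le> 4" using card_mono[OF finite_block assms] by (simp add: card_block)
  then consider "odd (card X)" | "card X = 0" | "card X = 2" | "card X = 4"
    by (cases "odd (card X)") (auto elim!: evenE, linarith)
  then show ?thesis
  proof cases
    case 1
    then have "odd (card (block p - X))" using le cardc by simp
    with 1 show ?thesis by (simp add: tilings_odd)
  next
    case 2
    then have "X = {}" using fin by simp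
    then show ?thesis by (simp add: tilings_empty card_tilings_block)
  next
    case 3
    have "X \<in> dominoes \<longleftrightarrow> block p - X \<in> dominoes"
      using domino_complement[of X p] domino_complement[of "block p - X" p] assms
      by (auto simp: double_diff)
    moreover have "card (block p - X) = 2" using 3 cardc by simp
    ultimately show ?thesis using 3 by (simp add: tilings_pair)
  next
    case 4
    then have "X = block p" using assms card_subset_eq[OF finite_block assms] card_block by simp
    then show ?thesis using 4 by (simp add: tilings_empty card_tilings_block power4_eq_xxxx)
  qed
qed

section \<open>Splitting a tiling along blocks\<close>

text \<open>
  The covering condition counts the blocks whose part contains a given cell, instead of asking for
  a disjoint union: under complementation in the blocks these counts are simply subtracted from
  the number of blocks through the cell.  Being extensional makes the choice \<open>U\<close> unique outside
  \<open>P\<close>, so that splittings can be counted.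
\<close>

definition splittings :: "'p set \<Rightarrow> ('p \<Rightarrow> 'c set) \<Rightarrow> 'c set \<Rightarrow> ('p \<Rightarrow> 'c set) set" where
  "splittings P B R =
     {U \<in> (\<Pi>\<^sub>E p\<in>P. Pow (B p)). \<forall>c. card {p \<in> P. c \<in> U p} = of_bool (c \<in> R)}"

lemma finite_splittings:
  assumes "finite P" "\<And>p. p \<in> P \<Longrightarrow> finite (B p)"
  shows "finite (splittings P B R)"
proof -
  have "finite (\<Pi>\<^sub>E p\<in>P. Pow (B p))" using assms by (intro finite_PiE) auto
  then show ?thesis by (rule rev_finite_subset) (auto simp: splittings_def)
qed

lemma splittings_unique:
  assumes "U \<in> splittings P B R" "c \<in> R"
  shows "\<exists>!p. p \<in> P \<and> c \<in> U p"
proof -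
  have "card {p \<in> P. c \<in> U p} = 1" using assms by (simp add: splittings_def)
  then obtain p where "{p \<in> P. c \<in> U p} = {p}" by (auto simp only: card_1_singleton_iff One_nat_def)
  then show ?thesis by (intro ex1I[of _ p]) auto
qed

lemma splittings_subset:
  assumes "U \<in> splittings P B R" "p \<in> P" "finite P"
  shows "U p \<subseteq> R" "U p \<subseteq> B p"
proof -
  show "U p \<subseteq> B p" using assms by (auto simp: splittings_def PiE_iff)
  show "U p \<subseteq> R"
  proof
    fix c assume "c \<in> U p"
    then have "card {p \<in> P. c \<in> U p} \<noteq> 0" using assms(2,3) by auto
    moreover have "card {p \<in> P. c \<in> U p} = of_bool (c \<in> R)"
      using assms(1) by (simp add: splittings_def)
    ultimately have "of_bool (c \<in> R) \<noteq> (0 :: nat)" by (simp only: not_False_eq_True)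
    then show "c \<in> R" by simp
  qed
qed

lemma splittingsI:
  assumes "U \<in> (\<Pi>\<^sub>E p\<in>P. Pow (B p))" "\<And>p. p \<in> P \<Longrightarrow> U p \<subseteq> R"
    and "\<And>c. c \<in> R \<Longrightarrow> \<exists>!p. p \<in> P \<and> c \<in> U p"
  shows "U \<in> splittings P B R"
proof -
  have "card {p \<in> P. c \<in> U p} = of_bool (c \<in> R)" for c
  proof (cases "c \<in> R")
    case True
    then obtain p where "{p \<in> P. c \<in> U p} = {p}" using assms(3)[of c] by blast
    then show ?thesis using True by simp
  next
    case False
    then have empty: "{p \<in> P. c \<in> U p} = {}" using assms(2) by auto
    show ?thesis unfolding empty using False by simp
  qed
  then show ?thesis using assms by (auto simp: splittings_def)
qed

text \<open>
  Tilings of \<open>R\<close> correspond to pairs of a splitting \<open>U\<close> and a choice of a tiling of each part.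
  Gluing the chosen tilings together is undone by sorting the dominoes according to the unique
  block that contains them, and the part \<open>U p\<close> is recovered as the union of the dominoes in \<open>B p\<close>.
\<close>

lemma card_tilings_split:
  assumes P: "finite P" and B: "\<And>p. p \<in> P \<Longrightarrow> finite (B p)"
    and uniq: "\<And>D. D \<in> dominoes \<Longrightarrow> D \<subseteq> R \<Longrightarrow> \<exists>!p. p \<in> P \<and> D \<subseteq> B p"
  shows "card (tilings R) = (\<Sum>U\<in>splittings P B R. \<Prod>p\<in>P. card (tilings (U p)))"
proof -
  define A where "A = (SIGMA U:splittings P B R. \<Pi>\<^sub>E p\<in>P. tilings (U p))"
  define glue where "glue = (\<lambda>(U :: 'a \<Rightarrow> (int \<times> int) set, F). \<Union> (F ` P) :: (int \<times> int) set set)"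
  define part where "part = (\<lambda>M :: (int \<times> int) set set. \<lambda>p\<in>P. {D \<in> M. D \<subseteq> B p})"
  define split where "split = (\<lambda>M. (\<lambda>p\<in>P. \<Union> (part M p), part M))"
  have 1: "glue z \<in> tilings R \<and> split (glue z) = z" if "z \<in> A" for z
  proof -
    obtain U F where z: "z = (U, F)" by (cases z)
    have U: "U \<in> splittings P B R" and F: "F \<in> (\<Pi>\<^sub>E p\<in>P. tilings (U p))"
      using that z by (auto simp: A_def)
    have Ft: "F p \<in> tilings (U p)" if "p \<in> P" for p using F that by auto
    have dom: "D \<in> dominoes \<and> D \<subseteq> U p \<and> D \<subseteq> R \<and> D \<subseteq> B p" if "p \<in> P" "D \<in> F p" for p D
      using Ft[OF that(1)] that splittings_subset[OF U that(1) P] by (auto simp: tilings_alt)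
    have Upart: "\<Union> (F p) = U p" if "p \<in> P" for p using Ft[OF that] by (auto simp: tilings_alt)
    have "\<Union> (glue z) = R"
      using Upart splittings_subset[OF U _ P] splittings_unique[OF U]
      by (auto simp: z glue_def) (metis Union_iff)
    moreover have "disjoint (glue z)"
    proof (rule disjointI)
      fix D E assume "D \<in> glue z" "E \<in> glue z" "D \<noteq> E"
      then obtain p q where pq: "p \<in> P" "q \<in> P" "D \<in> F p" "E \<in> F q" by (auto simp: z glue_def)
      show "D \<inter> E = {}"
      proof (cases "p = q")
        case True
        then show ?thesis using Ft[OF pq(1)] pq \<open>D \<noteq> E\<close> by (auto simp: tilings_alt disjoint_def)
      next
        case False
        then show ?thesis using dom[OF pq(1,3)] dom[OF pq(2,4)] splittings_unique[OF U] pq by blast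
      qed
    qed
    ultimately have gl: "glue z \<in> tilings R" using dom by (auto simp: tilings_alt z glue_def)
    have "part (glue z) p = F p" if p: "p \<in> P" for p
    proof -
      have other: "D \<in> F p" if "q \<in> P" "D \<in> F q" "D \<subseteq> B p" for D q
        using dom[OF that(1,2)] uniq[of D] that p by auto
      show "part (glue z) p = F p"
      proof (intro equalityI subsetI)
        fix D assume "D \<in> part (glue z) p"
        then obtain q where "q \<in> P" "D \<in> F q" "D \<subseteq> B p"
          using p by (auto simp: part_def z glue_def)
        then show "D \<in> F p" by (rule other)
      next
        fix D assume D: "D \<in> F p"
        then have "D \<subseteq> B p" using dom[OF p] by simp
        with D p show "D \<in> part (glue z) p" by (auto simp: part_def z glue_def)
      qed
    qed
    then have pF: "part (glue z) = F"
      using F by (intro ext) (auto simp: part_def PiE_iff extensional_def)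
    have "(\<lambda>p\<in>P. \<Union> (F p)) = U"
      using Upart U by (intro ext) (auto simp: splittings_def PiE_iff extensional_def)
    then show ?thesis using gl pF by (simp add: split_def z)
  qed
  have 2: "split M \<in> A \<and> glue (split M) = M" if M: "M \<in> tilings R" for M
  proof -
    have MD: "D \<in> dominoes" "D \<subseteq> R" if "D \<in> M" for D using M that by (auto simp: tilings_alt)
    have disj: "D = E" if "D \<in> M" "E \<in> M" "c \<in> D" "c \<in> E" for D E c
      using that M by (auto simp: tilings_alt disjoint_def)
    have parts: "part M p \<in> tilings (\<Union> (part M p))" if "p \<in> P" for p
      using M that by (auto simp: part_def tilings_alt disjoint_def)
    have "(\<lambda>p\<in>P. \<Union> (part M p)) \<in> splittings P B R"
    proof (rule splittingsI)
      fix c assume "c \<in> R"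
      then obtain D where D: "D \<in> M" "c \<in> D" using M by (auto simp: tilings_alt)
      obtain p where p: "p \<in> P" "D \<subseteq> B p" using uniq[OF MD[OF D(1)]] by auto
      show "\<exists>!p. p \<in> P \<and> c \<in> (\<lambda>p\<in>P. \<Union> (part M p)) p"
      proof (rule ex1I[of _ p])
        show "p \<in> P \<and> c \<in> (\<lambda>p\<in>P. \<Union> (part M p)) p" using p D by (auto simp: part_def)
      next
        fix q assume q: "q \<in> P \<and> c \<in> (\<lambda>p\<in>P. \<Union> (part M p)) q"
        then obtain E where "E \<in> M" "c \<in> E" "E \<subseteq> B q" by (auto simp: part_def)
        then have "D \<subseteq> B q" using disj D by blast
        then show "q = p" using uniq[OF MD[OF D(1)]] p q by blast
      qed
    qed (use MD in \<open>auto simp: part_def\<close>)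
    moreover have "part M \<in> (\<Pi>\<^sub>E p\<in>P. tilings ((\<lambda>p\<in>P. \<Union> (part M p)) p))"
      using parts by (auto simp: part_def)
    moreover have "\<Union> (part M ` P) = M"
      using uniq MD by (auto simp: part_def) blast
    ultimately show ?thesis by (simp add: A_def split_def glue_def)
  qed
  have "bij_betw glue A (tilings R)"
    by (rule bij_betw_byWitness[where f' = split]) (use 1 2 in auto)
  then have "card (tilings R) = card A" by (simp add: bij_betw_same_card)
  also have "\<dots> = (\<Sum>U\<in>splittings P B R. card (\<Pi>\<^sub>E p\<in>P. tilings (U p)))"
    unfolding A_def
  proof (rule card_SigmaI)
    show "finite (splittings P B R)" using P B by (rule finite_splittings)
    show "\<forall>U\<in>splittings P B R. finite (\<Pi>\<^sub>E p\<in>P. tilings (U p))"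
      using P B by (auto intro!: finite_PiE finite_tilings dest: splittings_subset finite_subset)
  qed
  also have "\<dots> = (\<Sum>U\<in>splittings P B R. \<Prod>p\<in>P. card (tilings (U p)))"
    using P by (simp add: card_PiE)
  finally show ?thesis .
qed

lemma sum_card_splitting:
  assumes U: "U \<in> splittings P B R" and P: "finite P" and R: "finite R"
  shows "(\<Sum>p\<in>P. card (U p)) = card R"
proof -
  have "(\<Sum>p\<in>P. card (U p)) = (\<Sum>p\<in>P. \<Sum>c\<in>R. of_bool (c \<in> U p))"
    using splittings_subset[OF U _ P] R by (intro sum.cong) (auto simp: Int_absorb1)
  also have "\<dots> = (\<Sum>c\<in>R. \<Sum>p\<in>P. of_bool (c \<in> U p))" by (rule sum.swap)
  also have "\<dots> = (\<Sum>c\<in>R. 1)"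
    using U P by (intro sum.cong) (auto simp: splittings_def Int_def)
  finally show ?thesis by simp
qed

text \<open>
  If the number of blocks through each cell is the sum of the indicators of \<open>R\<close> and \<open>R'\<close>, then a
  cell covered \<open>[c \<in> R]\<close> times by the parts is covered \<open>[c \<in> R']\<close> times by their complements.  The
  hypothesis is symmetric in \<open>R\<close> and \<open>R'\<close>, and complementing twice is the identity.
\<close>

lemma bij_betw_complement_splittings:
  assumes P: "finite P"
    and deg: "\<And>c. card {p \<in> P. c \<in> B p} = of_bool (c \<in> R) + of_bool (c \<in> R')"
  shows "bij_betw (\<lambda>U. \<lambda>p\<in>P. B p - U p) (splittings P B R) (splittings P B R')"
proof -
  have compl: "(\<lambda>p\<in>P. B p - U p) \<in> splittings P B S'"
    if deg: "\<And>c. card {p \<in> P. c \<in> B p} = of_bool (c \<in> S) + of_bool (c \<in> S')"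
      and U: "U \<in> splittings P B S" for S S' U
  proof -
    have "card {p \<in> P. c \<in> (\<lambda>p\<in>P. B p - U p) p} = of_bool (c \<in> S')" for c
    proof -
      have "{p \<in> P. c \<in> (\<lambda>p\<in>P. B p - U p) p} = {p \<in> P. c \<in> B p} - {p \<in> P. c \<in> U p}" by auto
      also have "card \<dots> = card {p \<in> P. c \<in> B p} - card {p \<in> P. c \<in> U p}"
        using splittings_subset[OF U _ P] P by (intro card_Diff_subset) auto
      finally show ?thesis using U by (simp add: deg splittings_def)
    qed
    then show ?thesis by (auto simp: splittings_def)
  qed
  have inv: "(\<lambda>p\<in>P. B p - (\<lambda>p\<in>P. B p - U p) p) = U" if "U \<in> splittings P B S" for U S
    using that by (intro ext) (auto simp: splittings_def PiE_iff extensional_def)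
  show ?thesis
    by (rule bij_betw_byWitness[where f' = "\<lambda>U. \<lambda>p\<in>P. B p - U p"])
      (use inv compl[OF deg] compl[of R' R] deg in \<open>auto simp: add.commute\<close>)
qed

section \<open>The Aztec diamond\<close>

definition aztec_cells :: "nat \<Rightarrow> (int \<times> int) set" where
  "aztec_cells n = {(a, b). \<forall>x\<in>{a, a + 1}. \<forall>y\<in>{b, b + 1}. \<bar>x\<bar> + \<bar>y\<bar> \<le> int n + 1}"

definition nodes :: "nat \<Rightarrow> (int \<times> int) set" where
  "nodes m = {(x, y). \<bar>x\<bar> + \<bar>y\<bar> \<le> int m \<and> even (x + y + int m)}"

lemma finite_aztec_cells: "finite (aztec_cells n)"
  by (rule finite_subset[of _ "{- int n - 1..int n + 1} \<times> {- int n - 1..int n + 1}"])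
    (auto simp: aztec_cells_def)

text \<open>
  Rotating by 45 degrees turns the nodes into a square grid of side \<open>m + 1\<close>; the conditions
  \<open>\<bar>x + y\<bar> \<le> m\<close> and \<open>\<bar>x - y\<bar> \<le> m\<close> on the rotated coordinates together say \<open>\<bar>x\<bar> + \<bar>y\<bar> \<le> m\<close>.
\<close>

lemma nodes_eq_image:
  "nodes m = (\<lambda>(i, j). (i - j, i + j - int m)) ` ({0..int m} \<times> {0..int m})"
proof -
  have "(x, y) \<in> (\<lambda>(i, j). (i - j, i + j - int m)) ` ({0..int m} \<times> {0..int m})"
    if xy: "\<bar>x\<bar> + \<bar>y\<bar> \<le> int m" "even (x + y + int m)" for x y
  proof -
    obtain i where i: "x + y + int m = 2 * i" using evenE[OF xy(2)] by blast
    show ?thesis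
      by (rule image_eqI[of _ _ "(i, i - x)"]) (use xy(1) i in auto)
  qed
  then show ?thesis by (auto simp: nodes_def)
qed

lemma finite_nodes: "finite (nodes m)"
  by (simp add: nodes_eq_image)

lemma card_nodes: "card (nodes m) = (m + 1)\<^sup>2"
proof -
  have "inj_on (\<lambda>(i, j). (i - j, i + j - int m)) ({0..int m} \<times> {0..int m})"
    by (auto simp: inj_on_def)
  then show ?thesis
    by (simp add: nodes_eq_image card_image card_cartesian_product power2_eq_square nat_add_distrib)
qed

text \<open>
  The left-hand summands give the taxicab norm of the corner of the cell nearest to the origin; that of the farthest corner
  exceeds it by 2, one for each coordinate.
\<close>

lemma mem_aztec_cells:
  "(a, b) \<in> aztec_cells n \<longleftrightarrow>
     (if 0 \<le> a then a else - a - 1) + (if 0 \<le> b then b else - b - 1) < int n"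
  by (auto simp: aztec_cells_def)

lemma nodesI:
  assumes "\<bar>x\<bar> + \<bar>y\<bar> \<le> int m + 1" "even (x + y + int m)"
  shows "(x, y) \<in> nodes m"
proof -
  have "even (\<bar>x\<bar> + \<bar>y\<bar> + int m)" using assms(2) by (simp add: abs_if)
  then have "\<bar>x\<bar> + \<bar>y\<bar> \<noteq> int m + 1" by presburger
  then show ?thesis using assms by (simp add: nodes_def)
qed

text \<open>
  Only two of the corners of a cell, opposite to each other, have the parity of \<open>m\<close>.  At least one
  of them is within taxicab distance \<open>m\<close> of the origin exactly for the cells of the diamond of order
  \<open>m + 1\<close>, and both of them exactly for those of the diamond of order \<open>m\<close>.
\<close>

lemma card_blocks_through_cell:
  "card {p \<in> nodes m. c \<in> block p} = of_bool (c \<in> aztec_cells (Suc m)) + of_bool (c \<in> aztec_cells m)"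
proof -
  obtain a b where c: "c = (a, b)" by (cases c)
  define Q where "Q = {(a, b), (a + 1, b), (a, b + 1), (a + 1, b + 1)}"
  have "card {p \<in> nodes m. c \<in> block p} = card (Q \<inter> nodes m)"
    by (rule arg_cong[of _ _ card]) (auto simp: Q_def c mem_block)
  also have "\<dots> = (\<Sum>p\<in>Q. of_bool (p \<in> nodes m))" by (simp add: Q_def Int_def)
  also have "\<dots> = of_bool ((a, b) \<in> nodes m) + of_bool ((a + 1, b) \<in> nodes m)
      + of_bool ((a, b + 1) \<in> nodes m) + of_bool ((a + 1, b + 1) \<in> nodes m)"
    by (simp add: Q_def)
  also have "\<dots> = of_bool (c \<in> aztec_cells (Suc m)) + of_bool (c \<in> aztec_cells m)"
  proof (cases "even (a + b + int m)")
    case True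
    then obtain k where "a + b + int m = 2 * k" by (rule evenE)
    then have m: "int m = 2 * k - a - b" by simp
    have corners: "(a, b) \<in> nodes m \<longleftrightarrow> \<bar>a\<bar> + \<bar>b\<bar> \<le> int m"
      "(a + 1, b + 1) \<in> nodes m \<longleftrightarrow> \<bar>a + 1\<bar> + \<bar>b + 1\<bar> \<le> int m"
      "(a + 1, b) \<notin> nodes m" "(a, b + 1) \<notin> nodes m"
      unfolding nodes_def using True by auto
    have some: "c \<in> aztec_cells (Suc m) \<longleftrightarrow> (a, b) \<in> nodes m \<or> (a + 1, b + 1) \<in> nodes m"
      unfolding c mem_aztec_cells corners of_nat_Suc m
      by (cases "0 \<le> a"; cases "0 \<le> b"; auto; presburger)
    have both: "c \<in> aztec_cells m \<longleftrightarrow> (a, b) \<in> nodes m \<and> (a + 1, b + 1) \<in> nodes m"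
      unfolding c mem_aztec_cells corners m
      by (cases "0 \<le> a"; cases "0 \<le> b"; auto; presburger)
    show ?thesis unfolding some both by (simp add: corners(3,4))
  next
    case False
    then obtain k where "a + b + int m = 2 * k + 1" by (rule oddE)
    then have m: "int m = 2 * k + 1 - a - b" by simp
    have corners: "(a + 1, b) \<in> nodes m \<longleftrightarrow> \<bar>a + 1\<bar> + \<bar>b\<bar> \<le> int m"
      "(a, b + 1) \<in> nodes m \<longleftrightarrow> \<bar>a\<bar> + \<bar>b + 1\<bar> \<le> int m"
      "(a, b) \<notin> nodes m" "(a + 1, b + 1) \<notin> nodes m"
      unfolding nodes_def using False by auto
    have some: "c \<in> aztec_cells (Suc m) \<longleftrightarrow> (a + 1, b) \<in> nodes m \<or> (a, b + 1) \<in> nodes m"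
      unfolding c mem_aztec_cells corners of_nat_Suc m
      by (cases "0 \<le> a"; cases "0 \<le> b"; auto; presburger)
    have both: "c \<in> aztec_cells m \<longleftrightarrow> (a + 1, b) \<in> nodes m \<and> (a, b + 1) \<in> nodes m"
      unfolding c mem_aztec_cells corners m
      by (cases "0 \<le> a"; cases "0 \<le> b"; auto; presburger)
    show ?thesis unfolding some both by (simp add: corners(3,4))
  qed
  finally show ?thesis .
qed

text \<open>
  The centres of the blocks containing a domino are the two end points of the edge shared by its
  cells, and exactly one of them has the parity of \<open>m\<close>.  This one is within taxicab distance \<open>m + 1\<close> of
  the origin because the domino lies in the diamond, hence within distance \<open>m\<close> by parity.
\<close>

lemma domino_in_unique_block:
  assumes "D \<in> dominoes" "D \<subseteq> aztec_cells (Suc m)"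
  shows "\<exists>!p. p \<in> nodes m \<and> D \<subseteq> block p"
proof -
  obtain a b where "D = {(a, b), (a, b + 1)} \<or> D = {(a, b), (a + 1, b)}"
    using assms by (auto simp: dominoes_def)
  then show ?thesis
  proof
    assume D: "D = {(a, b), (a, b + 1)}"
    have in_block: "D \<subseteq> block (x, y) \<longleftrightarrow> (x = a \<or> x = a + 1) \<and> y = b + 1" for x y
      unfolding D by (auto simp: mem_block)
    define x where "x = (if even (a + b + 1 + int m) then a else a + 1)"
    have x: "x = a \<or> x = a + 1" "even (x + (b + 1) + int m)"
      by (auto simp: x_def)
    have "\<bar>x\<bar> + \<bar>b + 1\<bar> \<le> int m + 1"
      using assms(2) x(1) unfolding D by (auto simp: mem_aztec_cells split: if_splits)
    then have "(x, b + 1) \<in> nodes m" using x(2) by (rule nodesI)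
    then have "(x, b + 1) \<in> nodes m \<and> D \<subseteq> block (x, b + 1)" using x(1) in_block by simp
    moreover have "p = (x, b + 1)" if p: "p \<in> nodes m \<and> D \<subseteq> block p" for p
    proof -
      obtain x' y' where xy: "p = (x', y')" by (cases p)
      have "(x', y') \<in> nodes m" using p unfolding xy by blast
      then have "even (x' + y' + int m)" by (simp add: nodes_def)
      moreover have "x' = a \<or> x' = a + 1" and "y' = b + 1"
        using p in_block[of x' y'] unfolding xy by blast+
      ultimately have "x' = x \<and> y' = b + 1" using x by presburger
      then show ?thesis by (simp add: xy)
    qed
    ultimately show ?thesis by (rule ex1I)
  next
    assume D: "D = {(a, b), (a + 1, b)}"
    have in_block: "D \<subseteq> block (x, y) \<longleftrightarrow> x = a + 1 \<and> (y = b \<or> y = b + 1)" for x y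
      unfolding D by (auto simp: mem_block)
    define y where "y = (if even (a + 1 + b + int m) then b else b + 1)"
    have y: "y = b \<or> y = b + 1" "even (a + 1 + y + int m)"
      by (auto simp: y_def)
    have "\<bar>a + 1\<bar> + \<bar>y\<bar> \<le> int m + 1"
      using assms(2) y(1) unfolding D by (auto simp: mem_aztec_cells split: if_splits)
    then have "(a + 1, y) \<in> nodes m" using y(2) by (rule nodesI)
    then have "(a + 1, y) \<in> nodes m \<and> D \<subseteq> block (a + 1, y)" using y(1) in_block by simp
    moreover have "p = (a + 1, y)" if p: "p \<in> nodes m \<and> D \<subseteq> block p" for p
    proof -
      obtain x' y' where xy: "p = (x', y')" by (cases p)
      have "(x', y') \<in> nodes m" using p unfolding xy by blast
      then have "even (x' + y' + int m)" by (simp add: nodes_def)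
      moreover have "x' = a + 1" and "y' = b \<or> y' = b + 1"
        using p in_block[of x' y'] unfolding xy by blast+
      ultimately have "x' = a + 1 \<and> y' = y" using y by presburger
      then show ?thesis by (simp add: xy)
    qed
    ultimately show ?thesis by (rule ex1I)
  qed
qed

lemma aztec_cells_mono: "aztec_cells m \<subseteq> aztec_cells (Suc m)"
  by (auto simp: aztec_cells_def)

lemma aztec_cells_0: "aztec_cells 0 = {}"
  by (auto simp: mem_aztec_cells split: if_splits)

text \<open>
  Counting incidences between cells and blocks gives
  \<open>card (aztec_cells (Suc m)) + card (aztec_cells m) = 4 (m + 1)\<^sup>2\<close>.
\<close>

lemma card_aztec_cells: "card (aztec_cells m) = 2 * m * (m + 1)"
proof (induction m)
  case 0
  then show ?case by (simp add: aztec_cells_0)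
next
  case (Suc m)
  let ?S = "aztec_cells (Suc m)"
  have blk: "block p \<subseteq> ?S" if "p \<in> nodes m" for p
    using that by (cases p) (auto simp: nodes_def block_eq aztec_cells_def)
  have "4 * card (nodes m) = (\<Sum>p\<in>nodes m. card (block p))" by (simp add: card_block)
  also have "\<dots> = (\<Sum>p\<in>nodes m. \<Sum>c\<in>?S. of_bool (c \<in> block p))"
    using blk finite_aztec_cells by (intro sum.cong) (auto simp: Int_absorb1)
  also have "\<dots> = (\<Sum>c\<in>?S. \<Sum>p\<in>nodes m. of_bool (c \<in> block p))" by (rule sum.swap)
  also have "\<dots> = (\<Sum>c\<in>?S. 1 + of_bool (c \<in> aztec_cells m))"
    using card_blocks_through_cell[of m] finite_nodes
    by (intro sum.cong) (auto simp: Int_def)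
  also have "\<dots> = card ?S + card (aztec_cells m)"
    unfolding sum.distrib using aztec_cells_mono[of m] by (simp add: finite_aztec_cells Int_absorb1)
  finally show ?case by (simp add: card_nodes Suc power2_eq_square algebra_simps)
qed

text \<open>
  The weights of a splitting and of its complement are compared block by block; the number of
  blocks and the number of cells determine the ratio of the two products.
\<close>

lemma card_tilings_Suc:
  "card (tilings (aztec_cells (Suc m))) = 2 ^ Suc m * card (tilings (aztec_cells m))"
proof -
  let ?P = "nodes m"
  let ?S = "splittings ?P block"
  let ?t = "\<lambda>X. real (card (tilings X))"
  have split: "?t R = (\<Sum>U\<in>?S R. \<Prod>p\<in>?P. ?t (U p))" if "R \<subseteq> aztec_cells (Suc m)" for R
    using card_tilings_split[of ?P block R] finite_nodes finite_block domino_in_unique_block that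
    by (simp add: subset_trans)
  have bij: "bij_betw (\<lambda>U. \<lambda>p\<in>?P. block p - U p) (?S (aztec_cells (Suc m))) (?S (aztec_cells m))"
    by (intro bij_betw_complement_splittings finite_nodes card_blocks_through_cell)
  have weight: "2 ^ (m + 1)\<^sup>2 * (\<Prod>p\<in>?P. ?t (U p))
      = (\<Prod>p\<in>?P. ?t (block p - U p)) * 2 ^ ((m + 1) * (m + 2))"
    if U: "U \<in> ?S (aztec_cells (Suc m))" for U
  proof -
    have "2 ^ (m + 1)\<^sup>2 * (\<Prod>p\<in>?P. ?t (U p)) = (\<Prod>p\<in>?P. 2 * ?t (U p))"
      by (simp add: prod.distrib card_nodes)
    also have "\<dots> = (\<Prod>p\<in>?P. ?t (block p - U p) * sqrt 2 ^ card (U p))"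
      using splittings_subset(2)[OF U _ finite_nodes] by (intro prod.cong local_complement) auto
    also have "\<dots> = (\<Prod>p\<in>?P. ?t (block p - U p)) * sqrt 2 ^ (\<Sum>p\<in>?P. card (U p))"
      by (simp add: prod.distrib power_sum)
    also have "(\<Sum>p\<in>?P. card (U p)) = 2 * ((m + 1) * (m + 2))"
      using sum_card_splitting[OF U finite_nodes finite_aztec_cells]
      by (simp add: card_aztec_cells algebra_simps)
    also have "sqrt 2 ^ (2 * ((m + 1) * (m + 2))) = 2 ^ ((m + 1) * (m + 2))"
      unfolding power_mult[of _ 2] by simp
    finally show ?thesis .
  qed
  have "2 ^ (m + 1)\<^sup>2 * ?t (aztec_cells (Suc m))
      = (\<Sum>U\<in>?S (aztec_cells (Suc m)). 2 ^ (m + 1)\<^sup>2 * (\<Prod>p\<in>?P. ?t (U p)))"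
    by (simp add: split sum_distrib_left)
  also have "\<dots> = (\<Sum>U\<in>?S (aztec_cells (Suc m)).
      (\<Prod>p\<in>?P. ?t ((\<lambda>p\<in>?P. block p - U p) p)) * 2 ^ ((m + 1) * (m + 2)))"
    using weight by (intro sum.cong) auto
  also have "\<dots> = (\<Sum>U\<in>?S (aztec_cells m). (\<Prod>p\<in>?P. ?t (U p)) * 2 ^ ((m + 1) * (m + 2)))"
    by (rule sum.reindex_bij_betw[OF bij])
  also have "\<dots> = ?t (aztec_cells m) * 2 ^ ((m + 1) * (m + 2))"
    by (simp add: split aztec_cells_mono sum_distrib_right)
  also have "(m + 1) * (m + 2) = (m + 1)\<^sup>2 + Suc m"
    by (simp add: power2_eq_square algebra_simps)
  finally have "?t (aztec_cells (Suc m)) = real (2 ^ Suc m * card (tilings (aztec_cells m)))"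
    by (simp add: power_add)
  then show ?thesis by (simp only: of_nat_eq_iff)
qed

lemma card_tilings_aztec: "card (tilings (aztec_cells n)) = 2 ^ (n * (n + 1) div 2)"
proof (induction n)
  case 0
  then show ?case by (simp add: aztec_cells_0 tilings_empty)
next
  case (Suc n)
  have "Suc n * (Suc n + 1) div 2 = Suc n + n * (n + 1) div 2"
    by (simp add: algebra_simps) 
  then show ?case by (simp only: card_tilings_Suc Suc power_add)
qed

section \<open>From regions of the plane to sets of cells\<close>

definition region :: "(int \<times> int) set \<Rightarrow> (real \<times> real) set" where
  "region X = (\<Union>(a, b)\<in>X. unit_square a b)"

text \<open>
  The centre of a unit square belongs to no other unit square, so a region built from unit squares
  remembers its cells.
\<close>

lemma center_in_region: 
  "(real_of_int a + 1 / 2, real_of_int b + 1 / 2) \<in> region X \<longleftrightarrow> (a, b) \<in> X"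
proof -
  have 1: "i = a" if "real_of_int i \<le> real_of_int a + 1 / 2" "real_of_int a + 1 / 2 \<le> real_of_int i + 1" for a i
    using that by linarith
  show ?thesis by (auto simp: region_def unit_square_def lattice_rect_def dest!: 1) force
qed

lemma inj_region: "inj region"
  by (rule injI) (metis center_in_region set_eq_iff prod.collapse)

lemma region_Union: "region (\<Union> M) = \<Union> (region ` M)"
  by (auto simp: region_def)

lemma aztec_diamond_eq_region: "aztec_diamond n = region (aztec_cells n)"
  by (auto simp: aztec_diamond_def region_def aztec_cells_def)

lemma region_domino:
  "region {(a, b), (a, b + 1)} = lattice_rect a b 1 2"
  "region {(a, b), (a + 1, b)} = lattice_rect a b 2 1"
  by (auto simp: region_def unit_square_def lattice_rect_def)

lemma is_domino_iff: "is_domino D \<longleftrightarrow> D \<in> region ` dominoes"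
  unfolding is_domino_def region_domino[symmetric] dominoes_def by blast

lemma interior_lattice_rect:
  "interior (lattice_rect a b w h) =
     {real_of_int a <..< real_of_int a + real w} \<times> {real_of_int b <..< real_of_int b + real h}"
  by (simp add: lattice_rect_def interior_Times)

lemma domino_as_rect:
  assumes "D \<in> dominoes"
  obtains a b w h where "D = {a..<a + int w} \<times> {b..<b + int h}" "region D = lattice_rect a b w h"
proof -
  have i: "{a..<a + 1} = {a}" "{a..<a + 2} = {a, a + 1}" for a :: int by auto
  from assms obtain a b where "D = {(a, b), (a, b + 1)} \<or> D = {(a, b), (a + 1, b)}"
    by (auto simp: dominoes_def)
  then show thesis
  proof
    assume D: "D = {(a, b), (a, b + 1)}"
    show thesis by (rule that[of a 1 b 2]) (auto simp: D i region_domino)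
  next
    assume D: "D = {(a, b), (a + 1, b)}"
    show thesis by (rule that[of a 2 b 1]) (auto simp: D i region_domino)
  qed
qed

text \<open>
  If two open intervals with integer end points meet, then they share the unit interval that starts
  at the larger of the left end points.
\<close>

lemma overlap:
  fixes a a' :: int
  assumes "real_of_int a < x" "x < real_of_int a + real w" 
    "real_of_int a' < x" "x < real_of_int a' + real w'"
  shows "max a a' \<in> {a..<a + int w} \<inter> {a'..<a' + int w'}"
  using assms by auto

text \<open>
  A common cell puts its centre into both interiors; conversely, the interiors are open boxes with
  integer corners, and two such boxes that meet share a whole cell.
\<close>

lemma interior_disjoint_iff:
  assumes D: "D \<in> dominoes" and E: "E \<in> dominoes"
  shows "interior (region D) \<inter> interior (region E) = {} \<longleftrightarrow> D \<inter> E = {}"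
proof -
  obtain a b w h where 1: "D = {a..<a + int w} \<times> {b..<b + int h}" "region D = lattice_rect a b w h"
    using domino_as_rect[OF D] .
  obtain a' b' w' h' where 2: "E = {a'..<a' + int w'} \<times> {b'..<b' + int h'}" "region E = lattice_rect a' b' w' h'"
    using domino_as_rect[OF E] .
  show ?thesis
  proof
    assume *: "interior (region D) \<inter> interior (region E) = {}"
    have "(i, j) \<notin> D \<inter> E" for i j
    proof
      assume ij: "(i, j) \<in> D \<inter> E"
      then have "(real_of_int i + 1 / 2, real_of_int j + 1 / 2) \<in> interior (region D) \<inter> interior (region E)"
        unfolding 1(2) 2(2) interior_lattice_rect using 1(1) 2(1) by auto
      then show False using * by simp
    qed
    then show "D \<inter> E = {}" by auto
  next
    assume *: "D \<inter> E = {}"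
    show "interior (region D) \<inter> interior (region E) = {}"
    proof (rule ccontr)
      assume "interior (region D) \<inter> interior (region E) \<noteq> {}"
      then obtain x y where "(x, y) \<in> interior (region D)" "(x, y) \<in> interior (region E)" by auto
      then have "(max a a', max b b') \<in> D \<inter> E"
        unfolding 1(2) 2(2) interior_lattice_rect
        using overlap[of a x w a' w'] overlap[of b y h b' h'] 1(1) 2(1) by auto
      then show False using * by simp
    qed
  qed
qed

lemma domino_tiling_region:
  "{T. domino_tiling (region R) T} = image region ` tilings R"
proof (rule set_eqI)
  fix T
  have *: "domino_tiling (region R) (region ` M) \<longleftrightarrow> M \<in> tilings R" if M: "M \<subseteq> dominoes" for M
  proof -
    have "\<Union> (region ` M) = region R \<longleftrightarrow> \<Union> M = R"
      by (metis inj_region region_Union inj_eq)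
    moreover have "(\<forall>D\<in>region ` M. \<forall>E\<in>region ` M. D \<noteq> E \<longrightarrow> interior D \<inter> interior E = {}) \<longleftrightarrow> disjoint M"
      using M interior_disjoint_iff by (auto simp: disjoint_def inj_eq[OF inj_region] subset_iff)
    ultimately show ?thesis using M by (auto simp: domino_tiling_def tilings_alt is_domino_iff)
  qed
  show "T \<in> {T. domino_tiling (region R) T} \<longleftrightarrow> T \<in> image region ` tilings R"
  proof
    assume T: "T \<in> {T. domino_tiling (region R) T}"
    then have "T \<subseteq> region ` dominoes" by (auto simp: domino_tiling_def is_domino_iff)
    then obtain M where "M \<subseteq> dominoes" "T = region ` M" by (auto simp: subset_image_iff)
    then show "T \<in> image region ` tilings R" using T * by auto
  next
    assume "T \<in> image region ` tilings R"
    then show "T \<in> {T. domino_tiling (region R) T}" using * by (auto simp: tilings_alt)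
  qed
qed

theorem theorem2p3:
  fixes n :: nat
  assumes "n \<ge> 1"
  shows "card {T. domino_tiling (aztec_diamond n) T} = 2 ^ (n * (n + 1) div 2)"
proof -
  have "card {T. domino_tiling (aztec_diamond n) T} = card (image region ` tilings (aztec_cells n))"
    by (simp add: aztec_diamond_eq_region domino_tiling_region)
  also have "\<dots> = card (tilings (aztec_cells n))"
    by (intro card_image inj_on_image inj_on_subset[OF inj_region]) simp
  finally show ?thesis by (simp add: card_tilings_aztec)
qed

end
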